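(* Let $D=(v,init(v),next(v,v'),J)$ be a program of size $m$ with $k=|J|$ fairness conditions, and let $\phi$ be a $CTL^*$ specification formula (in negation normal form) of size $n$. Then the translation system ${\textsf{Trans}}$ produces a set of clauses $Clauses(v,init(v),next(v,v'),J,\phi)$ consisting of $O(n(n+k))$ clauses, with a total size of $O(n(n+k)(n+m))$.
   Context: Fix a first-order background theory $\mathcal{T}$ with domain $\mathcal{E}$; an assertion is a formula of $\mathcal{T}$. A program is $D=(v,init(v),next(v,v'),J)$ where $v$ is a finite tuple of variables, $init(v)$ is an assertion (or a predicate application) over $v$, $next(v,v')$ is an assertion over $v$ and a primed copy $v'$, and $J=\{J_1,\dots,J_k\}$ is a finite list of assertions over $v$ (fairness conditions). States are valuations of $v$ in $\mathcal{E}$; a path is an infinite sequence of states $s_0s_1\dots$ with $next(s_i,s_{i+1})$ for all $i$; a path is fair if every $J_i$ holds at infinitely many of its states (if $J=\emptyset$ every path is fair). $CTL^*$ formulas are in negation normal form (negation only on assertions), built from assertions with $\wedge,\vee$, temporal operators $X,G,U$ (and $F\psi=\mathit{true}\,U\,\psi$), and path quantifiers $A,E$ (over all paths from a state) and $A_f,E_f$ (over fair paths from a state). $D\models\phi$ iff every state satisfying $init$ satisfies $\phi$. A basic state formula is $Q\psi$ with $Q$ a path quantifier and $\psi$ a path formula containing no path quantifiers. $\phi_1(\phi_2)$ denotes a formula with one or more occurrences of a subformula $\phi_2$, and $\phi_1(\gamma)$ the result of replacing them by $\gamma$. Clauses (Existential Horn Clauses) are implications $body\to head$ over uninterpreted predicate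 symbols, with all free variables universally quantified, where bodies/heads are built from assertions and predicate applications (heads may contain $\exists$), together with constraints $dwf(r)$ for binary (pairs-of-states) predicates $r$, meaning the interpretation of $r$ is disjunctively well-founded. The size of a clause set is the total length of its clauses. ${\textsf{Trans}}$ is the nondeterministic recursive procedure computing $Clauses(v,init(v),next(v,v'),J,\phi)$ (write $D$ for the first four arguments) by the following rules, each applied whenever its pattern matches; any set obtainable is a result of ${\textsf{Trans}}$. (1) If $\phi_1$ is a basic state subformula of $\phi_2(\phi_1)$, with $aux$ a fresh predicate of arity $|v|$: $Clauses(D,\phi_2(\phi_1))=Clauses(v,aux(v),next,J,\phi_1)\cup Clauses(D,\phi_2(aux(v)))$. (2) For a basic state formula $Q\psi$ with $Q\in\{A,E\}$ and $Q_f$ its fair version: $Clauses(D,Q\psi)=Clauses(v,init,next,\emptyset,Q_f\psi)$. (3) For an assertion $c$ and fresh boolean variable $x_X$: $Clauses(D,A_f\psi(Xc))=Clauses(v\cup\{x_X\},init(v),next\wedge(x_X=c(v')),J,A_f\psi(x_X))$; and with $aux$ fresh of arity $|v|+1$: $Clauses(D,E_f\psi(Xc))=\{init(v)\to\exists x_X\,aux(v,x_X)\}\cup Clauses(v\cup\{x_X\},aux(v,x_X),next\wedge(x_X=c(v')),J,E_f\psi(x_X))$. (4) Same as (3) with $Gc$, fresh $x_G$, conjunct $x_G=(c(v)\wedge x_G')$ added to $next$ and $J$ replaced by $J\cup\{x_G\vee\neg c(v)\}$. (5) Same as (3) with $c_1Uc_2$ ($c_1,c_2$ assertions), fresh $x_U$,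 conjunct $x_U=(c_2(v)\vee(c_1(v)\wedge x_U'))$ added to $next$ and $J$ replaced by $J\cup\{\neg x_U\vee c_2(v)\}$. (6) For an assertion $c$, fresh $p$ (arity $|v|$) and $r,t$ (arity $2|v|$), copies $v_0,\dots,v_k$ of $v$: if $J\ne\emptyset$, $Clauses(D,A_fc)=\{init(v)\wedge\neg c(v)\to p(v),\ next(v,v')\wedge p(v)\to p(v'),\ p(v_0)\wedge\bigwedge_{i=1}^{k}(t(v_{i-1},v_i)\wedge J_i(v_i))\to r(v_0,v_k),\ dwf(r),\ next(v,v')\to t(v,v'),\ t(v,v')\wedge next(v',v'')\to t(v,v'')\}$; if $J=\emptyset$, the same but with the third clause replaced by $p(v)\wedge t(v,v')\to r(v,v')$. (7) For an assertion $c$, fresh $q_1,\dots,q_k$ (arity $|v|$), $r_1,\dots,r_k$ (arity $2|v|$): if $J\neq\emptyset$, $Clauses(D,E_fc)=\{init(v)\to c(v)\wedge q_1(v)\}\cup\{q_i(v)\to\exists v'.\,next(v,v')\wedge((J_i(v)\wedge q_{(i\bmod k)+1}(v'))\vee(r_i(v,v')\wedge q_i(v'))),\ dwf(r_i),\ r_i(v,v')\wedge r_i(v',v'')\to r_i(v,v'')\mid i\le k\}$; if $J=\emptyset$, with $q$ fresh: $\{init(v)\to c(v)\wedge q(v),\ q(v)\to\exists v'.\,next(v,v')\wedge q(v')\}$. (8) For an assertion $c$: $Clauses(D,c)=\{init(v)\to c(v)\}$. *)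

theory Defs
  imports Main
begin

section \<open>Assertions and predicate applications\<close>

text \<open>
  Program variables range over the domain of the background theory (\<open>DVar\<close>) or over the booleans
  (\<open>BVar\<close>); the latter are only introduced by the translation.  A variable occurrence carries the
  number of the copy of the variable tuple it belongs to: 0 for \<open>v\<close>, 1 for \<open>v'\<close>, 2 for \<open>v''\<close>, etc.
\<close>

datatype pvar = DVar nat | BVar nat

type_synonym var = "pvar \<times> nat"

definition copy :: "nat \<Rightarrow> pvar list \<Rightarrow> var list" where
  "copy i vs = map (\<lambda>x. (x, i)) vs"

text \<open>
  First-order formulas over function symbols \<open>'f\<close> and relation symbols \<open>'r\<close> of the background theory,
  with boolean program variables and applications of uninterpreted predicate symbols (named by
  natural numbers) as further atoms.  \<open>TVar x i\<close> and \<open>BAtom x i\<close> stand for the program variables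
  \<open>(DVar x, i)\<close> and \<open>(BVar x, i)\<close>.  Variables bound by \<open>Forall\<close> and \<open>Exists\<close> are de Bruijn
  indices, so that renaming program variables cannot cause capture.
\<close>

datatype 'f tm = TVar nat nat | TBound nat | TFun 'f "'f tm list"

datatype ('f, 'r) fm =
    Tru
  | BAtom nat nat
  | Eql "'f tm" "'f tm"
  | Rel 'r "'f tm list"
  | Pred nat "var list"
  | Neg "('f, 'r) fm"
  | Conj "('f, 'r) fm" "('f, 'r) fm"
  | Disj "('f, 'r) fm" "('f, 'r) fm"
  | Iff "('f, 'r) fm" "('f, 'r) fm"
  | Forall "('f, 'r) fm"
  | Exists "('f, 'r) fm"

primrec shift_tm :: "nat \<Rightarrow> 'f tm \<Rightarrow> 'f tm" where
  "shift_tm k (TVar x i) = TVar x (i + k)"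
| "shift_tm k (TBound b) = TBound b"
| "shift_tm k (TFun f ts) = TFun f (map (shift_tm k) ts)"

text \<open>
  \<open>shift k c\<close> moves every variable \<open>k\<close> copies further: for an assertion \<open>c(v)\<close>, \<open>shift i c\<close> is
  \<open>c(v\<^sub>i)\<close>, and \<open>shift 1\<close> maps \<open>next(v,v')\<close> to \<open>next(v',v'')\<close>.
\<close>

primrec shift :: "nat \<Rightarrow> ('f, 'r) fm \<Rightarrow> ('f, 'r) fm" where
  "shift k Tru = Tru"
| "shift k (BAtom x i) = BAtom x (i + k)"
| "shift k (Eql s t) = Eql (shift_tm k s) (shift_tm k t)"
| "shift k (Rel r ts) = Rel r (map (shift_tm k) ts)"
| "shift k (Pred p xs) = Pred p (map (\<lambda>(x, i). (x, i + k)) xs)"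
| "shift k (Neg c) = Neg (shift k c)"
| "shift k (Conj c d) = Conj (shift k c) (shift k d)"
| "shift k (Disj c d) = Disj (shift k c) (shift k d)"
| "shift k (Iff c d) = Iff (shift k c) (shift k d)"
| "shift k (Forall c) = Forall (shift k c)"
| "shift k (Exists c) = Exists (shift k c)"

primrec fv_tm :: "'f tm \<Rightarrow> var set" where
  "fv_tm (TVar x i) = {(DVar x, i)}"
| "fv_tm (TBound b) = {}"
| "fv_tm (TFun f ts) = \<Union> (set (map fv_tm ts))"

primrec fv :: "('f, 'r) fm \<Rightarrow> var set" where
  "fv Tru = {}"
| "fv (BAtom x i) = {(BVar x, i)}"
| "fv (Eql s t) = fv_tm s \<union> fv_tm t"
| "fv (Rel r ts) = \<Union> (set (map fv_tm ts))"
| "fv (Pred p xs) = set xs"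
| "fv (Neg c) = fv c"
| "fv (Conj c d) = fv c \<union> fv d"
| "fv (Disj c d) = fv c \<union> fv d"
| "fv (Iff c d) = fv c \<union> fv d"
| "fv (Forall c) = fv c"
| "fv (Exists c) = fv c"

primrec preds :: "('f, 'r) fm \<Rightarrow> nat set" where
  "preds Tru = {}"
| "preds (BAtom x i) = {}"
| "preds (Eql s t) = {}"
| "preds (Rel r ts) = {}"
| "preds (Pred p xs) = {p}"
| "preds (Neg c) = preds c"
| "preds (Conj c d) = preds c \<union> preds d"
| "preds (Disj c d) = preds c \<union> preds d"
| "preds (Iff c d) = preds c \<union> preds d"
| "preds (Forall c) = preds c"
| "preds (Exists c) = preds c"

text \<open>No de Bruijn index points outside the enclosing \<open>b\<close> quantifiers.\<close>

primrec closed_tm :: "nat \<Rightarrow> 'f tm \<Rightarrow> bool" where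
  "closed_tm b (TVar x i) = True"
| "closed_tm b (TBound j) = (j < b)"
| "closed_tm b (TFun f ts) = list_all id (map (closed_tm b) ts)"

primrec closed_fm :: "nat \<Rightarrow> ('f, 'r) fm \<Rightarrow> bool" where
  "closed_fm b Tru = True"
| "closed_fm b (BAtom x i) = True"
| "closed_fm b (Eql s t) = (closed_tm b s \<and> closed_tm b t)"
| "closed_fm b (Rel r ts) = list_all (closed_tm b) ts"
| "closed_fm b (Pred p xs) = True"
| "closed_fm b (Neg c) = closed_fm b c"
| "closed_fm b (Conj c d) = (closed_fm b c \<and> closed_fm b d)"
| "closed_fm b (Disj c d) = (closed_fm b c \<and> closed_fm b d)"
| "closed_fm b (Iff c d) = (closed_fm b c \<and> closed_fm b d)"
| "closed_fm b (Forall c) = closed_fm (Suc b) c"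
| "closed_fm b (Exists c) = closed_fm (Suc b) c"

text \<open>
  An assertion (a formula of the background theory, hence without uninterpreted predicates) whose
  free variables belong to the first \<open>j\<close> copies of \<open>vs\<close>.
\<close>

definition assertion :: "pvar list \<Rightarrow> nat \<Rightarrow> ('f, 'r) fm \<Rightarrow> bool" where
  "assertion vs j c \<longleftrightarrow> preds c = {} \<and> closed_fm 0 c \<and> fv c \<subseteq> set vs \<times> {..<j}"

text \<open>Sizes count symbols; in particular a predicate application counts all its arguments.\<close>

primrec size_of_tm :: "'f tm \<Rightarrow> nat" where
  "size_of_tm (TVar x i) = 1"
| "size_of_tm (TBound b) = 1"
| "size_of_tm (TFun f ts) = 1 + sum_list (map size_of_tm ts)"

primrec size_of_fm :: "('f, 'r) fm \<Rightarrow> nat" where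
  "size_of_fm Tru = 1"
| "size_of_fm (BAtom x i) = 1"
| "size_of_fm (Eql s t) = 1 + size_of_tm s + size_of_tm t"
| "size_of_fm (Rel r ts) = 1 + sum_list (map size_of_tm ts)"
| "size_of_fm (Pred p xs) = 1 + length xs"
| "size_of_fm (Neg c) = 1 + size_of_fm c"
| "size_of_fm (Conj c d) = 1 + size_of_fm c + size_of_fm d"
| "size_of_fm (Disj c d) = 1 + size_of_fm c + size_of_fm d"
| "size_of_fm (Iff c d) = 1 + size_of_fm c + size_of_fm d"
| "size_of_fm (Forall c) = 1 + size_of_fm c"
| "size_of_fm (Exists c) = 1 + size_of_fm c"


section \<open>Programs\<close>

record ('f, 'r) program =
  pvars :: "pvar list"
  pinit :: "('f, 'r) fm"
  pnext :: "('f, 'r) fm"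
  pfair :: "('f, 'r) fm list"

definition wf_program :: "('f, 'r) program \<Rightarrow> bool" where
  "wf_program D \<longleftrightarrow>
     distinct (pvars D) \<and> set (pvars D) \<subseteq> range DVar \<and>
     (assertion (pvars D) 1 (pinit D) \<or>
      (\<exists>p xs. pinit D = Pred p xs \<and> set xs \<subseteq> set (copy 0 (pvars D)))) \<and>
     assertion (pvars D) 2 (pnext D) \<and>
     (\<forall>c \<in> set (pfair D). assertion (pvars D) 1 c)"

definition size_of_program :: "('f, 'r) program \<Rightarrow> nat" where
  "size_of_program D =
     length (pvars D) + size_of_fm (pinit D) + size_of_fm (pnext D)
       + sum_list (map size_of_fm (pfair D))"


section \<open>CTL* formulas in negation normal form\<close>

text \<open>\<open>QA\<close>, \<open>QE\<close> quantify over all paths, \<open>QAf\<close>, \<open>QEf\<close> over the fair ones.\<close>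

datatype pathq = QA | QE | QAf | QEf

fun fair_version :: "pathq \<Rightarrow> pathq" where
  "fair_version QA = QAf"
| "fair_version QE = QEf"
| "fair_version QAf = QAf"
| "fair_version QEf = QEf"

text \<open>State and path formulas together; \<open>'a\<close> is the type of assertions, which include negation.\<close>

datatype (assns: 'a) ctls =
    Assn 'a
  | And "'a ctls" "'a ctls"
  | Or "'a ctls" "'a ctls"
  | Nxt "'a ctls"
  | Glob "'a ctls"
  | Until "'a ctls" "'a ctls"
  | PathQ pathq "'a ctls"

abbreviation Fin :: "('f, 'r) fm ctls \<Rightarrow> ('f, 'r) fm ctls" where
  "Fin \<phi> \<equiv> Until (Assn Tru) \<phi>"

primrec state_formula :: "'a ctls \<Rightarrow> bool" where
  "state_formula (Assn c) = True"
| "state_formula (And \<phi> \<psi>) = (state_formula \<phi> \<and> state_formula \<psi>)"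
| "state_formula (Or \<phi> \<psi>) = (state_formula \<phi> \<and> state_formula \<psi>)"
| "state_formula (Nxt \<phi>) = False"
| "state_formula (Glob \<phi>) = False"
| "state_formula (Until \<phi> \<psi>) = False"
| "state_formula (PathQ Q \<psi>) = True"

primrec pathq_free :: "'a ctls \<Rightarrow> bool" where
  "pathq_free (Assn c) = True"
| "pathq_free (And \<phi> \<psi>) = (pathq_free \<phi> \<and> pathq_free \<psi>)"
| "pathq_free (Or \<phi> \<psi>) = (pathq_free \<phi> \<and> pathq_free \<psi>)"
| "pathq_free (Nxt \<phi>) = pathq_free \<phi>"
| "pathq_free (Glob \<phi>) = pathq_free \<phi>"
| "pathq_free (Until \<phi> \<psi>) = (pathq_free \<phi> \<and> pathq_free \<psi>)"
| "pathq_free (PathQ Q \<psi>) = False"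

definition basic :: "'a ctls \<Rightarrow> bool" where
  "basic \<phi> \<longleftrightarrow> (\<exists>Q \<psi>. \<phi> = PathQ Q \<psi> \<and> pathq_free \<psi>)"

definition spec_formula :: "('f, 'r) program \<Rightarrow> ('f, 'r) fm ctls \<Rightarrow> bool" where
  "spec_formula D \<phi> \<longleftrightarrow> state_formula \<phi> \<and> (\<forall>c \<in> assns \<phi>. assertion (pvars D) 1 c)"

primrec size_of_ctls :: "('f, 'r) fm ctls \<Rightarrow> nat" where
  "size_of_ctls (Assn c) = size_of_fm c"
| "size_of_ctls (And \<phi> \<psi>) = 1 + size_of_ctls \<phi> + size_of_ctls \<psi>"
| "size_of_ctls (Or \<phi> \<psi>) = 1 + size_of_ctls \<phi> + size_of_ctls \<psi>"
| "size_of_ctls (Nxt \<phi>) = 1 + size_of_ctls \<phi>"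
| "size_of_ctls (Glob \<phi>) = 1 + size_of_ctls \<phi>"
| "size_of_ctls (Until \<phi> \<psi>) = 1 + size_of_ctls \<phi> + size_of_ctls \<psi>"
| "size_of_ctls (PathQ Q \<psi>) = 1 + size_of_ctls \<psi>"

text \<open>
  Conjunctions and disjunctions of assertions are again assertions: \<open>is_assn \<phi> c\<close> says that the
  formula \<open>\<phi>\<close> is the assertion \<open>c\<close>.
\<close>

inductive is_assn :: "('f, 'r) fm ctls \<Rightarrow> ('f, 'r) fm \<Rightarrow> bool" where
  "is_assn (Assn c) c"
| "is_assn \<phi> c \<Longrightarrow> is_assn \<psi> d \<Longrightarrow> is_assn (And \<phi> \<psi>) (Conj c d)"
| "is_assn \<phi> c \<Longrightarrow> is_assn \<psi> d \<Longrightarrow> is_assn (Or \<phi> \<psi>) (Disj c d)"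

text \<open>
  \<open>repl \<alpha> \<gamma> \<phi> \<phi>'\<close>: \<open>\<phi>'\<close> arises from \<open>\<phi>\<close> by replacing any selection (possibly none) of occurrences of
  \<open>\<alpha>\<close> by \<open>\<gamma>\<close>.  In all uses \<open>\<gamma> \<noteq> \<alpha>\<close>, so \<open>\<phi>' \<noteq> \<phi>\<close> expresses that at least one occurrence is replaced.
\<close>

inductive repl :: "'a ctls \<Rightarrow> 'a ctls \<Rightarrow> 'a ctls \<Rightarrow> 'a ctls \<Rightarrow> bool" for \<alpha> \<gamma> where
  here: "repl \<alpha> \<gamma> \<alpha> \<gamma>"
| keep: "repl \<alpha> \<gamma> \<phi> \<phi>"
| conj: "repl \<alpha> \<gamma> \<phi> \<phi>' \<Longrightarrow> repl \<alpha> \<gamma> \<psi> \<psi>' \<Longrightarrow> repl \<alpha> \<gamma> (And \<phi> \<psi>) (And \<phi>' \<psi>')"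
| disj: "repl \<alpha> \<gamma> \<phi> \<phi>' \<Longrightarrow> repl \<alpha> \<gamma> \<psi> \<psi>' \<Longrightarrow> repl \<alpha> \<gamma> (Or \<phi> \<psi>) (Or \<phi>' \<psi>')"
| nxt: "repl \<alpha> \<gamma> \<phi> \<phi>' \<Longrightarrow> repl \<alpha> \<gamma> (Nxt \<phi>) (Nxt \<phi>')"
| glob: "repl \<alpha> \<gamma> \<phi> \<phi>' \<Longrightarrow> repl \<alpha> \<gamma> (Glob \<phi>) (Glob \<phi>')"
| until: "repl \<alpha> \<gamma> \<phi> \<phi>' \<Longrightarrow> repl \<alpha> \<gamma> \<psi> \<psi>' \<Longrightarrow> repl \<alpha> \<gamma> (Until \<phi> \<psi>) (Until \<phi>' \<psi>')"
| pathq: "repl \<alpha> \<gamma> \<psi> \<psi>' \<Longrightarrow> repl \<alpha> \<gamma> (PathQ Q \<psi>) (PathQ Q \<psi>')"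


section \<open>Existential Horn clauses\<close>

text \<open>
  \<open>Horn b xs h\<close> is the implication \<open>b \<longrightarrow> \<exists>xs. h\<close>, whose remaining free variables are universally
  quantified; \<open>DWF r\<close> is the constraint \<open>dwf(r)\<close> that the interpretation of the predicate symbol \<open>r\<close>
  is disjunctively well-founded.
\<close>

datatype ('f, 'r) clause =
    Horn "('f, 'r) fm" "var list" "('f, 'r) fm"
  | DWF nat

primrec size_of_clause :: "('f, 'r) clause \<Rightarrow> nat" where
  "size_of_clause (Horn b xs h) = 1 + size_of_fm b + length xs + size_of_fm h"
| "size_of_clause (DWF r) = 2"

definition size_of_clauses :: "('f, 'r) clause set \<Rightarrow> nat" where
  "size_of_clauses S = (\<Sum>cl\<in>S. size_of_clause cl)"


section \<open>The translation\<close>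

abbreviation app1 :: "nat \<Rightarrow> nat \<Rightarrow> pvar list \<Rightarrow> ('f, 'r) fm" where
  "app1 p i vs \<equiv> Pred p (copy i vs)"

abbreviation app2 :: "nat \<Rightarrow> nat \<Rightarrow> nat \<Rightarrow> pvar list \<Rightarrow> ('f, 'r) fm" where
  "app2 r i j vs \<equiv> Pred r (copy i vs @ copy j vs)"

text \<open>
  \<open>tester \<theta> x \<delta> Js\<close>: the temporal formula \<open>\<theta>\<close>, whose arguments are assertions, is represented by the
  boolean variable \<open>x\<close> by adding the conjunct \<open>\<delta>\<close> to \<open>next\<close> and the fairness conditions \<open>Js\<close> to \<open>J\<close>.
\<close>

inductive tester ::
  "('f, 'r) fm ctls \<Rightarrow> nat \<Rightarrow> ('f, 'r) fm \<Rightarrow> ('f, 'r) fm list \<Rightarrow> bool" where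
  nxt: "is_assn \<phi> c \<Longrightarrow>
    tester (Nxt \<phi>) x (Iff (BAtom x 0) (shift 1 c)) []"
| glob: "is_assn \<phi> c \<Longrightarrow>
    tester (Glob \<phi>) x (Iff (BAtom x 0) (Conj c (BAtom x 1))) [Disj (BAtom x 0) (Neg c)]"
| until: "is_assn \<phi> c1 \<Longrightarrow> is_assn \<psi> c2 \<Longrightarrow>
    tester (Until \<phi> \<psi>) x (Iff (BAtom x 0) (Disj c2 (Conj c1 (BAtom x 1))))
      [Disj (Neg (BAtom x 0)) c2]"

definition add_tester ::
  "nat \<Rightarrow> ('f, 'r) fm \<Rightarrow> ('f, 'r) fm list \<Rightarrow> ('f, 'r) program \<Rightarrow> ('f, 'r) program" where
  "add_tester x \<delta> Js D =
     D\<lparr>pvars := pvars D @ [BVar x], pnext := Conj (pnext D) \<delta>, pfair := pfair D @ Js\<rparr>"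

text \<open>
  The clauses for \<open>A\<^sub>f c\<close>.  With fairness conditions \<open>J\<^sub>1, \<dots>, J\<^sub>k\<close> (\<open>k > 0\<close>, the list being indexed from
  0) the body of the clause for \<open>r\<close> is \<open>p(v\<^sub>0) \<and> \<And>\<^sub>i (t(v\<^sub>i\<^sub>-\<^sub>1, v\<^sub>i) \<and> J\<^sub>i(v\<^sub>i))\<close>.
\<close>

definition all_fair_clauses ::
  "nat \<Rightarrow> nat \<Rightarrow> nat \<Rightarrow> ('f, 'r) program \<Rightarrow> ('f, 'r) fm \<Rightarrow> ('f, 'r) clause set" where
  "all_fair_clauses p r t D c =
     (let vs = pvars D; J = pfair D; k = length J in
      { Horn (Conj (pinit D) (Neg c)) [] (app1 p 0 vs),
        Horn (Conj (pnext D) (app1 p 0 vs)) [] (app1 p 1 vs),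
        (if J = [] then Horn (Conj (app1 p 0 vs) (app2 t 0 1 vs)) [] (app2 r 0 1 vs)
         else Horn
           (foldl Conj (app1 p 0 vs)
             (map (\<lambda>i. Conj (app2 t i (i + 1) vs) (shift (i + 1) (J ! i))) [0..<k]))
           [] (app2 r 0 k vs)),
        DWF r,
        Horn (pnext D) [] (app2 t 0 1 vs),
        Horn (Conj (app2 t 0 1 vs) (shift 1 (pnext D))) [] (app2 t 0 2 vs) })"

text \<open>The clauses for \<open>E\<^sub>f c\<close> with a nonempty list of fairness conditions, indexed from 0.\<close>

definition ex_fair_clauses ::
  "nat list \<Rightarrow> nat list \<Rightarrow> ('f, 'r) program \<Rightarrow> ('f, 'r) fm \<Rightarrow> ('f, 'r) clause set" where
  "ex_fair_clauses qs rs D c =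
     (let vs = pvars D; J = pfair D; k = length J in
      {Horn (pinit D) [] (Conj c (app1 (qs ! 0) 0 vs))} \<union>
      (\<Union>i<k.
        { Horn (app1 (qs ! i) 0 vs) (copy 1 vs)
            (Conj (pnext D)
              (Disj (Conj (J ! i) (app1 (qs ! ((i + 1) mod k)) 1 vs))
                    (Conj (app2 (rs ! i) 0 1 vs) (app1 (qs ! i) 1 vs)))),
          DWF (rs ! i),
          Horn (Conj (app2 (rs ! i) 0 1 vs) (app2 (rs ! i) 1 2 vs)) [] (app2 (rs ! i) 0 2 vs) }))"

definition ex_clauses ::
  "nat \<Rightarrow> ('f, 'r) program \<Rightarrow> ('f, 'r) fm \<Rightarrow> ('f, 'r) clause set" where
  "ex_clauses q D c =
     (let vs = pvars D in
      { Horn (pinit D) [] (Conj c (app1 q 0 vs)),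
        Horn (app1 q 0 vs) (copy 1 vs) (Conj (pnext D) (app1 q 1 vs)) })"

text \<open>
  \<open>trans_step U D \<phi> S U'\<close>: the set \<open>S\<close> is a possible value of \<open>Clauses(D, \<phi>)\<close> if the predicate symbols
  in \<open>U\<close> have already been used, and \<open>U'\<close> are the used symbols afterwards.  Threading this set
  through the recursive calls makes the fresh symbols globally fresh.

  The subformula extracted by rule \<open>sub\<close> is a proper one, and the rules for temporal operators apply
  to basic state formulas only.
\<close>

inductive trans_step ::
  "nat set \<Rightarrow> ('f, 'r) program \<Rightarrow> ('f, 'r) fm ctls \<Rightarrow> ('f, 'r) clause set \<Rightarrow> nat set \<Rightarrow> bool"
where
  sub:
  "\<lbrakk> basic \<chi>; \<chi> \<noteq> \<phi>; a \<notin> U;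
     repl \<chi> (Assn (app1 a 0 (pvars D))) \<phi> \<phi>'; \<phi>' \<noteq> \<phi>;
     trans_step (insert a U) (D\<lparr>pinit := app1 a 0 (pvars D)\<rparr>) \<chi> S1 U1;
     trans_step U1 D \<phi>' S2 U2 \<rbrakk>
   \<Longrightarrow> trans_step U D \<phi> (S1 \<union> S2) U2"
| unfair:
  "\<lbrakk> Q \<in> {QA, QE}; pathq_free \<psi>;
     trans_step U (D\<lparr>pfair := []\<rparr>) (PathQ (fair_version Q) \<psi>) S U' \<rbrakk>
   \<Longrightarrow> trans_step U D (PathQ Q \<psi>) S U'"
| temporal_all:
  "\<lbrakk> pathq_free \<psi>; tester \<theta> x \<delta> Js; BVar x \<notin> set (pvars D);
     repl \<theta> (Assn (BAtom x 0)) \<psi> \<psi>'; \<psi>' \<noteq> \<psi>;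
     trans_step U (add_tester x \<delta> Js D) (PathQ QAf \<psi>') S U' \<rbrakk>
   \<Longrightarrow> trans_step U D (PathQ QAf \<psi>) S U'"
| temporal_ex:
  "\<lbrakk> pathq_free \<psi>; tester \<theta> x \<delta> Js; BVar x \<notin> set (pvars D); a \<notin> U;
     repl \<theta> (Assn (BAtom x 0)) \<psi> \<psi>'; \<psi>' \<noteq> \<psi>;
     trans_step (insert a U)
       ((add_tester x \<delta> Js D)\<lparr>pinit := app1 a 0 (pvars D @ [BVar x])\<rparr>) (PathQ QEf \<psi>') S U' \<rbrakk>
   \<Longrightarrow> trans_step U D (PathQ QEf \<psi>)
         ({Horn (pinit D) [(BVar x, 0)] (app1 a 0 (pvars D @ [BVar x]))} \<union> S) U'"
| all_fair:
  "\<lbrakk> is_assn \<psi> c; distinct [p, r, t]; {p, r, t} \<inter> U = {} \<rbrakk>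
   \<Longrightarrow> trans_step U D (PathQ QAf \<psi>) (all_fair_clauses p r t D c) (U \<union> {p, r, t})"
| ex_fair:
  "\<lbrakk> is_assn \<psi> c; pfair D \<noteq> [];
     length qs = length (pfair D); length rs = length (pfair D);
     distinct (qs @ rs); set (qs @ rs) \<inter> U = {} \<rbrakk>
   \<Longrightarrow> trans_step U D (PathQ QEf \<psi>) (ex_fair_clauses qs rs D c) (U \<union> set (qs @ rs))"
| ex:
  "\<lbrakk> is_assn \<psi> c; pfair D = []; q \<notin> U \<rbrakk>
   \<Longrightarrow> trans_step U D (PathQ QEf \<psi>) (ex_clauses q D c) (insert q U)"
| assn:
  "is_assn \<phi> c \<Longrightarrow> trans_step U D \<phi> {Horn (pinit D) [] c} U"

definition Trans :: "('f, 'r) program \<Rightarrow> ('f, 'r) fm ctls \<Rightarrow> ('f, 'r) clause set \<Rightarrow> bool" where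
  "Trans D \<phi> S \<longleftrightarrow> (\<exists>U. trans_step (preds (pinit D)) D \<phi> S U)"

end

theory Submission
  imports Defs
begin

text \<open>
  Every use of rule \<open>sub\<close> splits off a basic state formula and replaces it by a single atom, so that
  the sizes of all the basic formulas translated add up to at most \<open>2n\<close>, provided that an atom
  \<open>aux(v)\<close> is counted as one symbol.  For a basic formula of size \<open>w\<close> the testers add at most \<open>w\<close>
  variables and fairness conditions, whence \<open>O(w + k)\<close> clauses.  Counting \<open>aux(v)\<close> in full, the
  formula has size at most \<open>w m\<close>, hence so does the transition relation with its testers up to a
  constant, and all clauses of this formula together have size \<open>O((w + k) w m)\<close>.  Both bounds are
  superadditive in \<open>w\<close>.
\<close>

section \<open>Sizes\<close>

text \<open>The cost of an assertion is a parameter: \<open>size_of_fm\<close> gives the true size,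
  \<open>trunc M\<close> the measure in which an atom \<open>aux(v)\<close> is cheap, and the
  constant 1 the induction measure for the existence of translations.\<close>

primrec weight :: "('a \<Rightarrow> nat) \<Rightarrow> 'a ctls \<Rightarrow> nat" where
  "weight g (Assn c) = g c"
| "weight g (And \<phi> \<psi>) = 1 + weight g \<phi> + weight g \<psi>"
| "weight g (Or \<phi> \<psi>) = 1 + weight g \<phi> + weight g \<psi>"
| "weight g (Nxt \<phi>) = 1 + weight g \<phi>"
| "weight g (Glob \<phi>) = 1 + weight g \<phi>"
| "weight g (Until \<phi> \<psi>) = 1 + weight g \<phi> + weight g \<psi>"
| "weight g (PathQ Q \<psi>) = 1 + weight g \<psi>"

text \<open>
  With \<open>M\<close> at least the size of \<open>aux(v)\<close>, the weight \<open>trunc M\<close> counts such an atom as one symbol,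
  while an assertion still has size at most \<open>M\<close> times its weight.
\<close>

definition trunc :: "nat \<Rightarrow> ('f, 'r) fm \<Rightarrow> nat" where
  "trunc M c = (if size_of_fm c \<le> M then 1 else size_of_fm c)"

lemma size_of_ctls_eq_weight: "size_of_ctls \<phi> = weight size_of_fm \<phi>"
  by (induction \<phi>) auto

lemma size_of_fm_pos: "1 \<le> size_of_fm c"
  by (cases c) auto

lemma trunc_pos: "1 \<le> trunc M c"
  using size_of_fm_pos[of c] by (simp add: trunc_def)

lemma weight_mono: "(\<And>c. f c \<le> g c) \<Longrightarrow> weight f \<phi> \<le> weight g \<phi>"
  by (induction \<phi>) (auto intro: add_mono)

lemma weight_pos: "(\<And>c. 1 \<le> g c) \<Longrightarrow> 1 \<le> weight g \<phi>"
  by (cases \<phi>) auto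

lemma weight_trunc_le_size: "weight (trunc M) \<phi> \<le> size_of_ctls \<phi>"
  unfolding size_of_ctls_eq_weight
  by (rule weight_mono) (use size_of_fm_pos in \<open>auto simp: trunc_def\<close>)

lemma weight_scale:
  assumes "1 \<le> M" "\<And>c. f c \<le> M * g c"
  shows "weight f \<phi> \<le> M * weight g \<phi>"
  using assms by (induction \<phi>) (auto simp: algebra_simps intro: add_mono)

lemma size_le_weight_trunc:
  assumes "1 \<le> M"
  shows "size_of_ctls \<phi> \<le> M * weight (trunc M) \<phi>"
  unfolding size_of_ctls_eq_weight
  by (rule weight_scale) (use assms in \<open>auto simp: trunc_def\<close>)

section \<open>Replacement of subformulas\<close>

lemma weight_repl_le:
  assumes "repl \<alpha> \<gamma> \<phi> \<phi>'" "weight g \<gamma> \<le> weight g \<alpha>"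
  shows "weight g \<phi>' \<le> weight g \<phi>"
  using assms by (induction rule: repl.induct) auto

text \<open>One genuine replacement already saves the difference of the weights, and further ones
  cannot raise the weight. The additive form avoids truncated subtraction.\<close>

lemma weight_repl:
  assumes "repl \<alpha> \<gamma> \<phi> \<phi>'" "\<phi>' \<noteq> \<phi>" "weight g \<gamma> \<le> weight g \<alpha>"
  shows "weight g \<phi>' + weight g \<alpha> \<le> weight g \<phi> + weight g \<gamma>"
  using assms
proof (induction rule: repl.induct)
  case (conj \<phi> \<phi>' \<psi> \<psi>')
  \<comment> \<open>Either side may be the one that changes: the induction hypothesis applies to it,
    and monotonicity to the other side.\<close>
  then show ?case
    using weight_repl_le[OF conj(1)] weight_repl_le[OF conj(2)] by (cases "\<phi>' = \<phi>") fastforce+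
next
  case (disj \<phi> \<phi>' \<psi> \<psi>')
  then show ?case
    using weight_repl_le[OF disj(1)] weight_repl_le[OF disj(2)] by (cases "\<phi>' = \<phi>") fastforce+
next
  case (until \<phi> \<phi>' \<psi> \<psi>')
  then show ?case
    using weight_repl_le[OF until(1)] weight_repl_le[OF until(2)] by (cases "\<phi>' = \<phi>") fastforce+
qed auto

lemma repl_pathq_free:
  assumes "repl \<alpha> \<gamma> \<phi> \<phi>'" "pathq_free \<phi>" "pathq_free \<gamma>"
  shows "pathq_free \<phi>'"
  using assms by (induction rule: repl.induct) auto

lemma repl_state_formula:
  assumes "repl \<alpha> \<gamma> \<phi> \<phi>'" "state_formula \<phi>" "state_formula \<gamma>"
  shows "state_formula \<phi>'"
  using assms by (induction rule: repl.induct) auto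

lemma repl_not_subformula:
  assumes "repl \<alpha> \<gamma> \<phi> \<phi>'" "pathq_free \<phi>" "\<not> pathq_free \<alpha>"
  shows "\<phi>' = \<phi>"
  using assms by (induction rule: repl.induct) auto

text \<open>The only quantifier of the formula is the outermost one, so it has no proper basic
  subformula. This excludes rule \<open>sub\<close> for basic formulas.\<close>

lemma repl_basic_trivial:
  assumes "repl \<chi> \<gamma> (PathQ Q \<psi>) \<phi>'" "pathq_free \<psi>" "basic \<chi>" "\<chi> \<noteq> PathQ Q \<psi>"
  shows "\<phi>' = PathQ Q \<psi>"
  using assms(1)
proof cases
  case (pathq \<psi>')
  then show ?thesis using repl_not_subformula[of \<chi> \<gamma> \<psi> \<psi>'] assms by (auto simp: basic_def)
qed (use assms in auto)

section \<open>Assertions and testers\<close>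

lemma is_assn_pathq_free: "is_assn \<phi> c \<Longrightarrow> pathq_free \<phi>"
  by (induction rule: is_assn.induct) auto

lemma is_assn_size: "is_assn \<phi> c \<Longrightarrow> size_of_fm c = size_of_ctls \<phi>"
  by (induction rule: is_assn.induct) auto

lemma not_is_assn_PathQ: "\<not> is_assn (PathQ Q \<psi>) c"
  by (auto elim: is_assn.cases)

lemma size_shift_tm [simp]: "size_of_tm (shift_tm k t) = size_of_tm t"
  by (induction t) (auto simp: o_def cong: map_cong)

lemma size_shift [simp]: "size_of_fm (shift k c) = size_of_fm c"
  by (induction c) (auto simp: o_def)

lemma length_copy [simp]: "length (copy i vs) = length vs"
  by (simp add: copy_def)

text \<open>The constant 4 is attained by \<open>Until\<close>, the constant 2 by
  \<open>Glob\<close>.\<close>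

lemma tester_size:
  assumes "tester \<theta> x \<delta> Js"
  shows "size_of_fm \<delta> \<le> size_of_ctls \<theta> + 4"
    and "sum_list (map size_of_fm Js) \<le> size_of_ctls \<theta> + 2"
    and "length Js \<le> 1"
  using assms by (induction rule: tester.induct) (auto simp: is_assn_size)

text \<open>The operator and an argument count at least 1 each, so putting an atom of weight 1 in
  place of \<open>\<theta>\<close> makes progress.\<close>

lemma tester_weight:
  assumes "tester \<theta> x \<delta> Js" "\<And>c. 1 \<le> g c"
  shows "2 \<le> weight g \<theta>"
  using assms(1) by cases (use weight_pos[of g, OF assms(2)] in \<open>auto intro: trans_le_add1\<close>)

text \<open>Strictness of the bound on the conjuncts leaves one symbol for each
  \<open>Conj\<close>.\<close>

lemma size_foldl_Conj:
  assumes "\<And>b. b \<in> set bs \<Longrightarrow> size_of_fm b < B"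
  shows "size_of_fm (foldl Conj a bs) \<le> size_of_fm a + length bs * B"
  using assms
proof (induction bs arbitrary: a)
  case (Cons b bs)
  have "size_of_fm (foldl Conj (Conj a b) bs) \<le> size_of_fm (Conj a b) + length bs * B"
    using Cons.prems by (intro Cons.IH) auto
  moreover have "size_of_fm b < B" using Cons.prems by auto
  ultimately show ?case by simp
qed auto

section \<open>Subadditivity of the size of clause sets\<close>

lemma size_of_clauses_Un:
  assumes "finite S" "finite T"
  shows "size_of_clauses (S \<union> T) \<le> size_of_clauses S + size_of_clauses T"
  using sum.union_inter[OF assms, of size_of_clause] by (simp add: size_of_clauses_def)

lemma size_of_clauses_insert:
  "finite S \<Longrightarrow> size_of_clauses (insert cl S) \<le> size_of_clause cl + size_of_clauses S"
  by (simp add: size_of_clauses_def sum.insert_if)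

lemma size_of_clauses_empty [simp]: "size_of_clauses {} = 0"
  by (simp add: size_of_clauses_def)

lemma size_of_clauses_UN:
  assumes "finite I" "\<And>i. i \<in> I \<Longrightarrow> finite (F i) \<and> size_of_clauses (F i) \<le> b"
  shows "size_of_clauses (\<Union>i\<in>I. F i) \<le> card I * b"
  using assms
proof (induction I rule: finite_induct)
  case (insert i I)
  have "size_of_clauses (F i \<union> (\<Union>i\<in>I. F i)) \<le> size_of_clauses (F i) + size_of_clauses (\<Union>i\<in>I. F i)"
    using insert by (intro size_of_clauses_Un) auto
  also have "\<dots> \<le> b + card I * b"
    using insert by (intro add_mono) auto
  finally show ?case using insert by simp
qed auto


section \<open>The clauses of a basic state formula\<close>

text \<open>
  The initial condition is bounded separately because rule \<open>temporal_ex\<close> replaces it by an atom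
  over the extended variable tuple.
\<close>

definition core_size :: "('f, 'r) program \<Rightarrow> nat" where
  "core_size D =
     length (pvars D) + size_of_fm (pnext D) + sum_list (map size_of_fm (pfair D))"

lemma size_fair_le_core: "c \<in> set (pfair D) \<Longrightarrow> size_of_fm c \<le> core_size D"
  using member_le_sum_list[of "size_of_fm c" "map size_of_fm (pfair D)"]
  by (auto simp: core_size_def)

text \<open>Only the clause for \<open>r\<close> grows with the number of fairness conditions, by
  one conjunct of size O(B) for each; the other clauses have size O(B).\<close>

lemma all_fair_clauses_bounds:
  assumes "core_size D + size_of_fm c \<le> B" "size_of_fm (pinit D) \<le> B"
  shows "finite (all_fair_clauses p r t D c)"
    and "card (all_fair_clauses p r t D c) \<le> 6"
    and "size_of_clauses (all_fair_clauses p r t D c) \<le> 50 * (length (pfair D) + 1) * B"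
proof -
  let ?vs = "pvars D" and ?J = "pfair D"
  let ?k = "length ?J"
  define body :: "('a, 'b) fm" where "body =
    foldl Conj (app1 p 0 ?vs)
      (map (\<lambda>i. Conj (app2 t i (i + 1) ?vs) (shift (i + 1) (?J ! i))) [0..<?k])"
  define cl :: "('a, 'b) clause" where "cl =
    (if ?J = [] then Horn (Conj (app1 p 0 ?vs) (app2 t 0 1 ?vs)) [] (app2 r 0 1 ?vs)
     else Horn body [] (app2 r 0 ?k ?vs))"
  have B: "length ?vs + size_of_fm (pnext D) + size_of_fm c \<le> B" and "1 \<le> B"
    using assms size_of_fm_pos[of c] by (auto simp: core_size_def)
  have "size_of_fm (?J ! i) \<le> B" if "i < ?k" for i
    using size_fair_le_core[of "?J ! i" D] that assms by simp
  \<comment> \<open>A conjunct consists of two variable tuples, one fairness condition and two more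
    symbols, hence is smaller than \<open>6 * B\<close>.\<close>
  then have "size_of_fm body \<le> size_of_fm (app1 p 0 ?vs :: ('a, 'b) fm) + ?k * (6 * B)"
    unfolding body_def using B \<open>1 \<le> B\<close>
    by (intro order_trans[OF size_foldl_Conj[where B = "6 * B"]]) fastforce+
  then have body: "size_of_fm body \<le> 2 * B + ?k * (6 * B)"
    using B \<open>1 \<le> B\<close> by simp
  have cl: "size_of_clause cl \<le> 10 * B + ?k * (6 * B)"
    using body B \<open>1 \<le> B\<close> by (simp add: cl_def)
  have eq: "all_fair_clauses p r t D c =
    {Horn (Conj (pinit D) (Neg c)) [] (app1 p 0 ?vs),
     Horn (Conj (pnext D) (app1 p 0 ?vs)) [] (app1 p 1 ?vs),
     cl, DWF r, Horn (pnext D) [] (app2 t 0 1 ?vs),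
     Horn (Conj (app2 t 0 1 ?vs) (shift 1 (pnext D))) [] (app2 t 0 2 ?vs)}"
    unfolding all_fair_clauses_def cl_def body_def Let_def by simp
  show "finite (all_fair_clauses p r t D c)" by (simp add: eq)
  show "card (all_fair_clauses p r t D c) \<le> 6"
    unfolding eq by (rule order_trans[OF card_length[of "[_, _, _, _, _, _]", simplified]]) simp
  have "size_of_clauses (all_fair_clauses p r t D c) \<le>
    size_of_clause (Horn (Conj (pinit D) (Neg c)) [] (app1 p 0 ?vs)) +
    (size_of_clause (Horn (Conj (pnext D) (app1 p 0 ?vs)) [] (app1 p 1 ?vs)) +
    (size_of_clause cl + (size_of_clause (DWF r :: ('a, 'b) clause) +
    (size_of_clause (Horn (pnext D) [] (app2 t 0 1 ?vs)) +
    (size_of_clause (Horn (Conj (app2 t 0 1 ?vs) (shift 1 (pnext D))) [] (app2 t 0 2 ?vs)) + 0)))))"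
    unfolding eq
    by (intro order_trans[OF size_of_clauses_insert] add_left_mono) auto
  also have "\<dots> \<le> 50 * B + ?k * (6 * B)"
    using cl B \<open>1 \<le> B\<close> assms by simp
  also have "\<dots> \<le> 50 * (?k + 1) * B" by (simp add: algebra_simps)
  finally show "size_of_clauses (all_fair_clauses p r t D c) \<le> 50 * (?k + 1) * B" .
qed

text \<open>Here every fairness condition yields three clauses of size O(B), besides the initial
  one.\<close>

lemma ex_fair_clauses_bounds:
  assumes "core_size D + size_of_fm c \<le> B" "size_of_fm (pinit D) \<le> B"
  shows "finite (ex_fair_clauses qs rs D c)"
    and "card (ex_fair_clauses qs rs D c) \<le> 1 + 3 * length (pfair D)"
    and "size_of_clauses (ex_fair_clauses qs rs D c) \<le> 50 * (length (pfair D) + 1) * B"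
proof -
  let ?vs = "pvars D" and ?J = "pfair D"
  let ?k = "length ?J"
  define init :: "('a, 'b) clause" where
    "init = Horn (pinit D) [] (Conj c (app1 (qs ! 0) 0 ?vs))"
  define F :: "nat \<Rightarrow> ('a, 'b) clause set" where "F i =
    {Horn (app1 (qs ! i) 0 ?vs) (copy 1 ?vs)
       (Conj (pnext D)
         (Disj (Conj (?J ! i) (app1 (qs ! ((i + 1) mod ?k)) 1 ?vs))
               (Conj (app2 (rs ! i) 0 1 ?vs) (app1 (qs ! i) 1 ?vs)))),
     DWF (rs ! i),
     Horn (Conj (app2 (rs ! i) 0 1 ?vs) (app2 (rs ! i) 1 2 ?vs)) [] (app2 (rs ! i) 0 2 ?vs)}" for i
  have eq: "ex_fair_clauses qs rs D c = insert init (\<Union>i<?k. F i)"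
    unfolding ex_fair_clauses_def F_def init_def Let_def by simp
  have B: "length ?vs + size_of_fm (pnext D) + size_of_fm c \<le> B" and "1 \<le> B"
    using assms size_of_fm_pos[of c] by (auto simp: core_size_def)
  have fin: "finite (F i)" for i by (simp add: F_def)
  then show "finite (ex_fair_clauses qs rs D c)" by (simp add: eq)
  have "card (F i) \<le> 3" for i
    unfolding F_def by (rule order_trans[OF card_length[of "[_, _, _]", simplified]]) simp
  then have "card (\<Union>i<?k. F i) \<le> 3 * ?k"
    using card_UN_le[of "{..<?k}" F] sum_bounded_above[of "{..<?k}" "\<lambda>i. card (F i)" 3]
    by (simp add: mult.commute)
  then show "card (ex_fair_clauses qs rs D c) \<le> 1 + 3 * ?k"
    using card_insert_le_m1[of "1 + 3 * ?k" "\<Union>i<?k. F i" init] by (simp add: eq)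
  have "size_of_clauses (F i) \<le> 40 * B" if "i < ?k" for i
  proof -
    have "size_of_fm (?J ! i) \<le> B"
      using size_fair_le_core[of "?J ! i" D] that assms by simp
    then show ?thesis
      unfolding F_def using B \<open>1 \<le> B\<close>
      by (intro order_trans[OF size_of_clauses_insert]
          order_trans[OF add_left_mono[OF size_of_clauses_insert]]
          order_trans[OF add_left_mono[OF add_left_mono[OF size_of_clauses_insert]]]) simp_all
  qed
  then have "size_of_clauses (\<Union>i<?k. F i) \<le> ?k * (40 * B)"
    using size_of_clauses_UN[of "{..<?k}" F "40 * B"] fin by simp
  moreover have "size_of_clause init \<le> 10 * B"
    using B \<open>1 \<le> B\<close> assms by (simp add: init_def)
  ultimately have "size_of_clauses (insert init (\<Union>i<?k. F i)) \<le> 10 * B + ?k * (40 * B)"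
    using size_of_clauses_insert[of "\<Union>i<?k. F i" init] fin by simp
  also have "\<dots> \<le> 50 * (?k + 1) * B" by (simp add: algebra_simps)
  finally show "size_of_clauses (ex_fair_clauses qs rs D c) \<le> 50 * (?k + 1) * B"
    by (simp add: eq)
qed

lemma ex_clauses_bounds:
  assumes "core_size D + size_of_fm c \<le> B" "size_of_fm (pinit D) \<le> B"
  shows "finite (ex_clauses q D c)"
    and "card (ex_clauses q D c) \<le> 2"
    and "size_of_clauses (ex_clauses q D c) \<le> 50 * B"
proof -
  let ?vs = "pvars D"
  have B: "length ?vs + size_of_fm (pnext D) + size_of_fm c \<le> B" and "1 \<le> B"
    using assms size_of_fm_pos[of c] by (auto simp: core_size_def)
  show "finite (ex_clauses q D c)" by (simp add: ex_clauses_def Let_def)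
  show "card (ex_clauses q D c) \<le> 2"
    unfolding ex_clauses_def Let_def
    by (rule order_trans[OF card_length[of "[_, _]", simplified]]) simp
  show "size_of_clauses (ex_clauses q D c) \<le> 50 * B"
    unfolding ex_clauses_def Let_def using B \<open>1 \<le> B\<close> assms
    by (intro order_trans[OF size_of_clauses_insert]
          order_trans[OF add_left_mono[OF size_of_clauses_insert]]) simp_all
qed

text \<open>
  The potential \<open>core_size D + 12 * size_of_ctls \<psi>\<close> does not increase when a tester is added: a
  temporal formula of size \<open>s \<ge> 2\<close> adds at most \<open>2 s + 8 \<le> 12 (s - 1)\<close> to the program.
\<close>

lemma core_size_add_tester:
  assumes "tester \<theta> x \<delta> Js" "repl \<theta> (Assn (BAtom x 0)) \<psi> \<psi>'" "\<psi>' \<noteq> \<psi>"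
  shows "core_size (add_tester x \<delta> Js D) + 12 * size_of_ctls \<psi>' \<le> core_size D + 12 * size_of_ctls \<psi>"
proof -
  have t: "2 \<le> size_of_ctls \<theta>"
    unfolding size_of_ctls_eq_weight by (rule tester_weight[OF assms(1) size_of_fm_pos])
  then have "size_of_ctls \<psi>' + size_of_ctls \<theta> \<le> size_of_ctls \<psi> + 1"
    using weight_repl[OF assms(2,3), of size_of_fm] by (simp add: size_of_ctls_eq_weight)
  then show ?thesis
    using tester_size(1,2)[OF assms(1)] t by (simp add: core_size_def add_tester_def)
qed

text \<open>This drop pays for the fairness condition that a tester may add and for the extra clause
  of \<open>temporal_ex\<close>.\<close>

lemma weight_trunc_add_tester:
  assumes "tester \<theta> x \<delta> Js" "repl \<theta> (Assn (BAtom x 0)) \<psi> \<psi>'" "\<psi>' \<noteq> \<psi>"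
  shows "weight (trunc M) \<psi>' + 1 \<le> weight (trunc M) \<psi>"
proof -
  have "2 \<le> weight (trunc M) \<theta>"
    by (rule tester_weight[OF assms(1) trunc_pos])
  moreover have "trunc M (BAtom x 0 :: ('a, 'b) fm) = 1" by (simp add: trunc_def)
  ultimately show ?thesis
    using weight_repl[OF assms(2,3), of "trunc M"] by simp
qed

text \<open>\<open>B\<close> stays fixed, as adding a tester does not raise the potential. Each
  tester lowers the weight by at least 1 and adds at most one fairness condition, worth three
  clauses, and one clause of its own: hence the coefficient 4. In the size bound both are worth
  \<open>50 * B\<close>, hence the coefficient 2.\<close>

lemma basic_bounds:
  assumes "trans_step U D (PathQ Q \<psi>) S U'" "pathq_free \<psi>"
    and "core_size D + 12 * size_of_ctls \<psi> \<le> B" "size_of_fm (pinit D) \<le> B"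
  shows "finite S \<and> card S \<le> 6 + 3 * length (pfair D) + 4 * weight (trunc M) \<psi> \<and>
    size_of_clauses S \<le> 50 * (length (pfair D) + 2 * weight (trunc M) \<psi> + 1) * B"
  using assms
proof (induction U D "PathQ Q \<psi>" S U' arbitrary: Q \<psi> rule: trans_step.induct)
  case sub
  then show ?case using repl_basic_trivial by blast
next
  case (unfair Q \<psi> U D S U')
  let ?w = "weight (trunc M) \<psi>"
  have IH: "finite S \<and> card S \<le> 6 + 3 * length (pfair (D\<lparr>pfair := []\<rparr>)) + 4 * ?w \<and>
    size_of_clauses S \<le> 50 * (length (pfair (D\<lparr>pfair := []\<rparr>)) + 2 * ?w + 1) * B"
    using unfair by (intro unfair.hyps(4)) (auto simp: core_size_def)
  have k: "length (pfair (D\<lparr>pfair := []\<rparr>)) \<le> length (pfair D)" by simp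
  have "50 * (length (pfair (D\<lparr>pfair := []\<rparr>)) + 2 * ?w + 1) * B
      \<le> 50 * (length (pfair D) + 2 * ?w + 1) * B"
    using k by (intro mult_le_mono) auto
  then show ?case using IH k by linarith
next
  case (temporal_all \<psi> \<theta> x \<delta> Js D \<psi>' U S U')
  let ?D = "add_tester x \<delta> Js D" and ?w = "weight (trunc M)"
  have IH: "finite S \<and> card S \<le> 6 + 3 * length (pfair ?D) + 4 * ?w \<psi>' \<and>
    size_of_clauses S \<le> 50 * (length (pfair ?D) + 2 * ?w \<psi>' + 1) * B"
  proof (rule temporal_all.hyps(7))
    show "pathq_free \<psi>'"
      using repl_pathq_free[OF temporal_all.hyps(4,1)] by simp
    show "core_size ?D + 12 * size_of_ctls \<psi>' \<le> B"
      using core_size_add_tester[OF temporal_all.hyps(2,4,5), of D] temporal_all.prems by linarith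
    show "size_of_fm (pinit ?D) \<le> B"
      using temporal_all.prems by (simp add: add_tester_def)
  qed
  have w: "?w \<psi>' + 1 \<le> ?w \<psi>"
    by (rule weight_trunc_add_tester[OF temporal_all.hyps(2,4,5)])
  have k: "length (pfair ?D) \<le> length (pfair D) + 1"
    using tester_size(3)[OF temporal_all.hyps(2)] by (simp add: add_tester_def)
  have "50 * (length (pfair ?D) + 2 * ?w \<psi>' + 1) * B
      \<le> 50 * (length (pfair D) + 2 * ?w \<psi> + 1) * B"
    using w k by (intro mult_le_mono) auto
  then show ?case using IH w k by linarith
next
  case (temporal_ex \<psi> \<theta> x \<delta> Js D a U \<psi>' S U')
  let ?h = "app1 a 0 (pvars D @ [BVar x]) :: ('a, 'b) fm"
  let ?D = "(add_tester x \<delta> Js D)\<lparr>pinit := ?h\<rparr>" and ?w = "weight (trunc M)"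
  let ?cl = "Horn (pinit D) [(BVar x, 0)] ?h"
  \<comment> \<open>The share of \<open>\<psi>\<close> in the potential leaves room in
    \<open>B\<close> for the new initial atom, whose size exceeds the length of \<open>v\<close> by
    two: the predicate symbol and \<open>x\<close>.\<close>
  have psi: "1 \<le> size_of_ctls \<psi>"
    unfolding size_of_ctls_eq_weight by (rule weight_pos) (rule size_of_fm_pos)
  then have l: "length (pvars D) + 12 \<le> B"
    using temporal_ex.prems by (simp add: core_size_def)
  have core: "core_size ?D = core_size (add_tester x \<delta> Js D)" by (simp add: core_size_def)
  have IH: "finite S \<and> card S \<le> 6 + 3 * length (pfair ?D) + 4 * ?w \<psi>' \<and>
    size_of_clauses S \<le> 50 * (length (pfair ?D) + 2 * ?w \<psi>' + 1) * B"
  proof (rule temporal_ex.hyps(8))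
    show "pathq_free \<psi>'"
      using repl_pathq_free[OF temporal_ex.hyps(5,1)] by simp
    show "core_size ?D + 12 * size_of_ctls \<psi>' \<le> B"
      using core_size_add_tester[OF temporal_ex.hyps(2,5,6), of D] temporal_ex.prems core
      by linarith
    show "size_of_fm (pinit ?D) \<le> B" using l by simp
  qed
  have w: "?w \<psi>' + 1 \<le> ?w \<psi>"
    by (rule weight_trunc_add_tester[OF temporal_ex.hyps(2,5,6)])
  have k: "length (pfair ?D) \<le> length (pfair D) + 1"
    using tester_size(3)[OF temporal_ex.hyps(2)] by (simp add: add_tester_def)
  have "size_of_clause ?cl \<le> 50 * B"
    using temporal_ex.prems l by simp
  moreover have "size_of_clauses ({?cl} \<union> S) \<le> size_of_clause ?cl + size_of_clauses S"
    unfolding insert_is_Un[symmetric] using size_of_clauses_insert IH by blast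
  ultimately have "size_of_clauses ({?cl} \<union> S)
      \<le> 50 * B + 50 * (length (pfair ?D) + 2 * ?w \<psi>' + 1) * B"
    using IH by linarith
  also have "\<dots> = 50 * (length (pfair ?D) + 2 * ?w \<psi>' + 2) * B"
    by (simp add: algebra_simps)
  also have "\<dots> \<le> 50 * (length (pfair D) + 2 * ?w \<psi> + 1) * B"
    using w k by (intro mult_le_mono) auto
  finally have "size_of_clauses ({?cl} \<union> S) \<le> 50 * (length (pfair D) + 2 * ?w \<psi> + 1) * B" .
  moreover have "card ({?cl} \<union> S) \<le> 1 + card S"
    using card_Un_le[of "{?cl}" S] by simp
  ultimately show ?case using IH w k by auto
next
  case (all_fair \<psi> c p r t U D)
  have c: "core_size D + size_of_fm c \<le> B"
    using all_fair.prems is_assn_size[OF all_fair.hyps(1)] by simp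
  have "50 * (length (pfair D) + 1) * B
      \<le> 50 * (length (pfair D) + 2 * weight (trunc M) \<psi> + 1) * B"
    by (intro mult_le_mono) auto
  then show ?case
    using all_fair_clauses_bounds[OF c all_fair.prems(3), of p r t] by linarith
next
  case (ex_fair \<psi> c D qs rs U)
  have c: "core_size D + size_of_fm c \<le> B"
    using ex_fair.prems is_assn_size[OF ex_fair.hyps(1)] by simp
  have "50 * (length (pfair D) + 1) * B
      \<le> 50 * (length (pfair D) + 2 * weight (trunc M) \<psi> + 1) * B"
    by (intro mult_le_mono) auto
  then show ?case
    using ex_fair_clauses_bounds[OF c ex_fair.prems(3), of qs rs] by linarith
next
  case (ex \<psi> c D q U)
  have c: "core_size D + size_of_fm c \<le> B"
    using ex.prems is_assn_size[OF ex.hyps(1)] by simp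
  have "50 * B \<le> 50 * (length (pfair D) + 2 * weight (trunc M) \<psi> + 1) * B"
    by simp
  then show ?case
    using ex_clauses_bounds[OF c ex.prems(3), of q] by linarith
next
  case assn
  then show ?case using not_is_assn_PathQ by blast
qed


section \<open>The clauses of a state formula\<close>

text \<open>Applies \<open>basic_bounds\<close> with \<open>B = 13 * (w * M)\<close>, where
  \<open>w\<close> is the weight of \<open>\<psi>\<close>, that is, the total weight minus 1 for the
  quantifier: one share covers the program, twelve cover the formula.\<close>

lemma basic_bounds_scaled:
  assumes "trans_step U D (PathQ Q \<psi>) S U'" "pathq_free \<psi>"
    and "core_size D + 1 \<le> M" "size_of_fm (pinit D) \<le> M"
    and "weight (trunc M) (PathQ Q \<psi>) \<le> N"
  shows "finite S \<and> card S \<le> 10 * ((weight (trunc M) (PathQ Q \<psi>) - 1) * (N + length (pfair D))) \<and>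
    size_of_clauses S
      \<le> 1950 * ((weight (trunc M) (PathQ Q \<psi>) - 1) * (N + length (pfair D)) * M)"
proof -
  let ?w = "weight (trunc M) \<psi>" and ?k = "length (pfair D)"
  have w: "1 \<le> ?w" by (rule weight_pos) (rule trunc_pos)
  have N: "?w + 1 \<le> N" using assms by simp
  have M: "M \<le> ?w * M" using w by simp
  have "12 * size_of_ctls \<psi> \<le> 12 * (?w * M)"
    using size_le_weight_trunc[of M \<psi>] assms by (simp add: mult.commute)
  then have "core_size D + 12 * size_of_ctls \<psi> \<le> 13 * (?w * M)"
    using M assms by linarith
  moreover have "size_of_fm (pinit D) \<le> 13 * (?w * M)"
    using M assms by linarith
  ultimately have fin: "finite S" and card: "card S \<le> 6 + 3 * ?k + 4 * ?w"
    and size: "size_of_clauses S \<le> 50 * (?k + 2 * ?w + 1) * (13 * (?w * M))"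
    using basic_bounds[OF assms(1,2)] by blast+
  have "6 + 3 * ?k + 4 * ?w \<le> 10 * (N + ?k)" using N by simp
  \<comment> \<open>The factor \<open>?w\<close> makes the bound linear in the weight, so that it
    can be summed over the formulas split off.\<close>
  also have "\<dots> \<le> 10 * (?w * (N + ?k))" using w by (intro mult_le_mono2) simp
  finally have "card S \<le> 10 * (?w * (N + ?k))" using card by linarith
  moreover have "50 * (?k + 2 * ?w + 1) * (13 * (?w * M)) \<le> 50 * (3 * (N + ?k)) * (13 * (?w * M))"
    using N by (intro mult_le_mono) auto
  then have "size_of_clauses S \<le> 1950 * (?w * (N + ?k) * M)"
    using size by (simp add: algebra_simps)
  ultimately show ?thesis using fin by simp
qed

text \<open>
  \<open>N\<close> stays fixed during the induction.  Since \<open>w - 1\<close> is superadditive under rule \<open>sub\<close>, only the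
  single clause of rule \<open>assn\<close> needs the additional summands.
\<close>

lemma state_formula_bounds:
  assumes "trans_step U D \<phi> S U'"
    and "core_size D + 1 \<le> M" "size_of_fm (pinit D) \<le> M" "weight (trunc M) \<phi> \<le> N"
  shows "finite S \<and> card S \<le> 10 * ((weight (trunc M) \<phi> - 1) * (N + length (pfair D))) + 1 \<and>
    size_of_clauses S \<le> 1950 * ((weight (trunc M) \<phi> - 1) * (N + length (pfair D)) * M) + 3 * (N * M)"
  using assms
proof (induction rule: trans_step.induct)
  case (sub \<chi> \<phi> a U D \<phi>' S1 U1 S2 U2)
  let ?w = "weight (trunc M)" and ?k = "length (pfair D)"
  let ?K = "N + ?k"
  obtain Q \<psi> where \<chi>: "\<chi> = PathQ Q \<psi>" "pathq_free \<psi>"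
    using sub.hyps(1) by (auto simp: basic_def)
  \<comment> \<open>The 1 added to \<open>core_size D\<close> in the hypothesis accounts for the
    predicate symbol of this atom.\<close>
  have a: "size_of_fm (app1 a 0 (pvars D) :: ('a, 'b) fm) \<le> M"
    using sub.prems by (simp add: core_size_def)
  then have wa: "trunc M (app1 a 0 (pvars D) :: ('a, 'b) fm) = 1"
    by (simp add: trunc_def)
  have pos: "1 \<le> ?w \<psi>" "1 \<le> ?w \<phi>'" by (rule weight_pos, rule trunc_pos)+
  have w: "?w \<phi>' + ?w \<chi> \<le> ?w \<phi> + 1"
    using weight_repl[OF sub.hyps(4,5), of "trunc M"] wa pos \<chi> by simp
  \<comment> \<open>The bound for basic formulas is used for \<open>\<chi>\<close> because the extra
    summands of the induction hypothesis would accumulate over the uses of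
    \<open>sub\<close>.\<close>
  have 1: "finite S1 \<and> card S1 \<le> 10 * ((?w \<chi> - 1) * ?K) \<and>
      size_of_clauses S1 \<le> 1950 * ((?w \<chi> - 1) * ?K * M)"
    using basic_bounds_scaled[OF sub.hyps(6)[unfolded \<chi>(1)] \<chi>(2), of M N] a sub.prems w pos
    by (simp add: core_size_def \<chi>(1))
  have 2: "finite S2 \<and> card S2 \<le> 10 * ((?w \<phi>' - 1) * ?K) + 1 \<and>
      size_of_clauses S2 \<le> 1950 * ((?w \<phi>' - 1) * ?K * M) + 3 * (N * M)"
    using sub.IH(2) sub.prems w \<chi> pos by simp
  have "(?w \<chi> - 1) + (?w \<phi>' - 1) \<le> ?w \<phi> - 1" using w pos \<chi> by simp
  then have K: "(?w \<chi> - 1) * ?K + (?w \<phi>' - 1) * ?K \<le> (?w \<phi> - 1) * ?K"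
    by (metis add_mult_distrib mult_le_mono1)
  then have KM: "(?w \<chi> - 1) * ?K * M + (?w \<phi>' - 1) * ?K * M \<le> (?w \<phi> - 1) * ?K * M"
    by (metis add_mult_distrib mult_le_mono1)
  have "card (S1 \<union> S2) \<le> card S1 + card S2" by (rule card_Un_le)
  moreover have "size_of_clauses (S1 \<union> S2) \<le> size_of_clauses S1 + size_of_clauses S2"
    using 1 2 by (intro size_of_clauses_Un) auto
  ultimately show ?case using 1 2 K KM by auto
next
  \<comment> \<open>In this and the following cases up to \<open>ex\<close> the formula is basic;
    applying the rule to its premises restores the derivation that
    \<open>basic_bounds_scaled\<close> takes.\<close>
  case (unfair Q \<psi> U D S U')
  then show ?case
    using basic_bounds_scaled[where M = M and N = N,
        OF trans_step.unfair[OF unfair.hyps(1-3)]]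
    by fastforce
next
  case (temporal_all \<psi> \<theta> x \<delta> Js D \<psi>' U S U')
  then show ?case
    using basic_bounds_scaled[where M = M and N = N,
        OF trans_step.temporal_all[OF temporal_all.hyps(1-6)]]
    by fastforce
next
  case (temporal_ex \<psi> \<theta> x \<delta> Js D a U \<psi>' S U')
  then show ?case
    using basic_bounds_scaled[where M = M and N = N,
        OF trans_step.temporal_ex[OF temporal_ex.hyps(1-7)]]
    by fastforce
next
  case (all_fair \<psi> c p r t U D)
  then show ?case
    using basic_bounds_scaled[where M = M and N = N,
        OF trans_step.all_fair[OF all_fair.hyps]]
      is_assn_pathq_free by fastforce
next
  case (ex_fair \<psi> c D qs rs U)
  then show ?case
    using basic_bounds_scaled[where M = M and N = N,
        OF trans_step.ex_fair[OF ex_fair.hyps]]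
      is_assn_pathq_free by fastforce
next
  case (ex \<psi> c D q U)
  then show ?case
    using basic_bounds_scaled[where M = M and N = N,
        OF trans_step.ex[OF ex.hyps]]
      is_assn_pathq_free by fastforce
next
  case (assn \<phi> c U D)
  have M: "1 \<le> M" using assn.prems by simp
  have N: "1 \<le> N" using weight_pos[of "trunc M" \<phi>] trunc_pos assn.prems by fastforce
  \<comment> \<open>The assertion may contain many atoms inserted by earlier replacements; each has
    weight 1 but may have size up to \<open>M\<close>.\<close>
  have "size_of_fm c \<le> M * weight (trunc M) \<phi>"
    using size_le_weight_trunc[OF M] is_assn_size[OF assn.hyps] by simp
  also have "\<dots> \<le> N * M" using assn.prems by simp
  finally have c: "size_of_fm c \<le> N * M" .
  have NM: "M \<le> N * M" using N by simp
  have "size_of_clauses {Horn (pinit D) [] c} = 1 + size_of_fm (pinit D) + size_of_fm c"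
    by (simp add: size_of_clauses_def)
  also have "\<dots> \<le> 3 * (N * M)" using c NM M assn.prems by linarith
  finally show ?case by simp
qed


section \<open>Every state formula has a translation\<close>

text \<open>Induction finds an innermost temporal operator: if its arguments are assertions it has a
  tester itself, otherwise a replacement inside an argument is carried outwards.\<close>

lemma assertion_or_temporal:
  assumes "pathq_free \<psi>"
  shows "(\<exists>c. is_assn \<psi> c) \<or>
    (\<exists>\<theta> \<delta> Js \<psi>'. tester \<theta> x \<delta> Js \<and> repl \<theta> (Assn b) \<psi> \<psi>' \<and> \<psi>' \<noteq> \<psi>)"
  using assms
proof (induction \<psi>)
  case (And \<phi> \<psi>)
  then show ?case
    by simp (metis ctls.inject(2) is_assn.intros(2) repl.conj repl.keep)
next
  case (Or \<phi> \<psi>)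
  then show ?case
    by simp (metis ctls.inject(3) is_assn.intros(3) repl.disj repl.keep)
next
  case (Nxt \<phi>)
  then show ?case
    by simp (metis ctls.distinct(5) ctls.inject(4) tester.nxt repl.nxt repl.here)
next
  case (Glob \<phi>)
  then show ?case
    by simp (metis ctls.distinct(7) ctls.inject(5) tester.glob repl.glob repl.here)
next
  case (Until \<phi> \<psi>)
  then show ?case
    by simp (metis ctls.distinct(9) ctls.inject(6) tester.until repl.until repl.here repl.keep)
qed (auto intro: is_assn.intros)

lemma ex_basic_subformula:
  assumes "\<not> pathq_free \<phi>"
  shows "\<exists>\<chi> \<phi>'. basic \<chi> \<and> repl \<chi> (Assn b) \<phi> \<phi>' \<and> \<phi>' \<noteq> \<phi>"
  using assms
proof (induction \<phi>)
  case (And \<phi> \<psi>)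
  then show ?case by simp (metis ctls.inject(2) repl.conj repl.keep)
next
  case (Or \<phi> \<psi>)
  then show ?case by simp (metis ctls.inject(3) repl.disj repl.keep)
next
  case (Nxt \<phi>)
  then show ?case by simp (metis ctls.inject(4) repl.nxt)
next
  case (Glob \<phi>)
  then show ?case by simp (metis ctls.inject(5) repl.glob)
next
  case (Until \<phi> \<psi>)
  then show ?case by simp (metis ctls.inject(6) repl.until repl.keep)
next
  case (PathQ Q \<psi>)
  show ?case
  proof (cases "pathq_free \<psi>")
    case True
    then have "basic (PathQ Q \<psi>)" by (auto simp: basic_def)
    then show ?thesis using repl.here by blast
  next
    case False
    then show ?thesis using PathQ by (metis ctls.inject(7) repl.pathq)
  qed
qed auto

lemma pathq_free_state_is_assn:
  "pathq_free \<phi> \<Longrightarrow> state_formula \<phi> \<Longrightarrow> \<exists>c. is_assn \<phi> c"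
  by (induction \<phi>) (auto intro: is_assn.intros)

lemma fresh_bool: "\<exists>x. BVar x \<notin> set vs"
proof -
  have "finite (BVar -` set vs)" by (rule finite_vimageI) (auto simp: inj_def)
  then show ?thesis using ex_new_if_finite[of "BVar -` set vs"] by auto
qed

text \<open>The weight drops whenever an atom replaces a temporal formula, until an assertion is
  left. Finiteness of the used symbols is carried along so that fresh ones remain available.\<close>

lemma fair_basic_translatable:
  assumes "finite U" "pathq_free \<psi>" "Q \<in> {QAf, QEf}"
  shows "\<exists>S U'. trans_step U D (PathQ Q \<psi>) S U' \<and> finite U'"
  using assms
proof (induction "weight (\<lambda>_. 1) \<psi>" arbitrary: U D \<psi> rule: less_induct)
  case (less \<psi> U D)
  \<comment> \<open>\<open>n\<close> exceeds every used symbol, so it and all larger numbers are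
    fresh.\<close>
  obtain n where n: "\<forall>u\<in>U. u < n"
    using less.prems(1) finite_nat_set_iff_bounded by blast
  show ?case
  proof (cases "\<exists>c. is_assn \<psi> c")
    case True
    then obtain c where c: "is_assn \<psi> c" ..
    consider "Q = QAf" | "Q = QEf" "pfair D = []" | "Q = QEf" "pfair D \<noteq> []"
      using less.prems by auto
    then show ?thesis
    proof cases
      case 1
      have "trans_step U D (PathQ Q \<psi>) (all_fair_clauses n (n+1) (n+2) D c) (U \<union> {n, n+1, n+2})"
        unfolding 1 by (rule trans_step.all_fair[OF c]) (use n in auto)
      then show ?thesis using less.prems by blast
    next
      case 2
      have "trans_step U D (PathQ Q \<psi>) (ex_clauses n D c) (insert n U)"
        unfolding 2 by (rule trans_step.ex[OF c]) (use n 2 in auto)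
      then show ?thesis using less.prems by blast
    next
      case 3
      let ?k = "length (pfair D)"
      let ?qs = "[n..<n + ?k]" and ?rs = "[n + ?k..<n + ?k + ?k]"
      have "trans_step U D (PathQ Q \<psi>) (ex_fair_clauses ?qs ?rs D c) (U \<union> set (?qs @ ?rs))"
        unfolding 3 by (rule trans_step.ex_fair[OF c]) (use n 3 in auto)
      then show ?thesis using less.prems by blast
    qed
  next
    case False
    obtain x where x: "BVar x \<notin> set (pvars D)" using fresh_bool by blast
    obtain \<theta> \<delta> Js \<psi>' where t: "tester \<theta> x \<delta> Js" "repl \<theta> (Assn (BAtom x 0)) \<psi> \<psi>'" "\<psi>' \<noteq> \<psi>"
      using assertion_or_temporal[OF less.prems(2), of x "BAtom x 0"] False by blast
    have "2 \<le> weight (\<lambda>_. 1) \<theta>" by (rule tester_weight[OF t(1)]) simp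
    then have "weight (\<lambda>_. 1) \<psi>' < weight (\<lambda>_. 1) \<psi>"
      using weight_repl[OF t(2,3), of "\<lambda>_. 1"] by simp
    moreover have "pathq_free \<psi>'" using repl_pathq_free[OF t(2)] less.prems by simp
    ultimately have IH: "finite V \<Longrightarrow> \<exists>S U'. trans_step V E (PathQ Q \<psi>') S U' \<and> finite U'" for V E
      using less by blast
    show ?thesis
    proof (cases "Q = QAf")
      case True
      then show ?thesis
        using IH[of U "add_tester x \<delta> Js D"] less.prems trans_step.temporal_all[OF _ t(1) x t(2,3)]
        by blast
    next
      case False
      then have "Q = QEf" using less.prems by auto
      moreover have "n \<notin> U" using n by auto
      ultimately show ?thesis
        using IH[of "insert n U" "(add_tester x \<delta> Js D)\<lparr>pinit := app1 n 0 (pvars D @ [BVar x])\<rparr>"]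
          less.prems trans_step.temporal_ex[OF _ t(1) x _ t(2,3)]
        by blast
    qed
  qed
qed

lemma basic_translatable:
  assumes "finite U" "basic \<chi>"
  shows "\<exists>S U'. trans_step U D \<chi> S U' \<and> finite U'"
proof -
  obtain Q \<psi> where \<chi>: "\<chi> = PathQ Q \<psi>" "pathq_free \<psi>" using assms by (auto simp: basic_def)
  show ?thesis
  proof (cases "Q \<in> {QA, QE}")
    case True
    then have "fair_version Q \<in> {QAf, QEf}" by auto
    from fair_basic_translatable[OF assms(1) \<chi>(2) this, of "D\<lparr>pfair := []\<rparr>"]
    show ?thesis unfolding \<chi>(1) using trans_step.unfair[OF True \<chi>(2)] by blast
  next
    case False
    then have "Q \<in> {QAf, QEf}" by (cases Q) auto
    from fair_basic_translatable[OF assms(1) \<chi>(2) this] show ?thesis unfolding \<chi>(1) .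
  qed
qed

text \<open>Repeatedly replaces a basic formula, of weight at least 2, by an atom counted as 1. The
  true size could grow here, since \<open>aux(v)\<close> lists the whole tuple.\<close>

lemma state_formula_translatable:
  assumes "finite U" "state_formula \<phi>"
  shows "\<exists>S U'. trans_step U D \<phi> S U' \<and> finite U'"
  using assms
proof (induction "weight (\<lambda>_. 1) \<phi>" arbitrary: U D \<phi> rule: less_induct)
  case (less \<phi> U D)
  show ?case
  proof (cases "pathq_free \<phi>")
    case True
    then show ?thesis
      using pathq_free_state_is_assn less.prems trans_step.assn by blast
  next
    case False
    obtain a where a: "a \<notin> U" using less.prems(1) ex_new_if_finite[of U] by auto
    obtain \<chi> \<phi>' where \<chi>: "basic \<chi>" "repl \<chi> (Assn (app1 a 0 (pvars D))) \<phi> \<phi>'" "\<phi>' \<noteq> \<phi>"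
      using ex_basic_subformula[OF False] by blast
    show ?thesis
    proof (cases "\<chi> = \<phi>")
      \<comment> \<open>Rule \<open>sub\<close> takes proper subformulas only, so a formula that is
        itself basic is translated directly.\<close>
      case True
      then show ?thesis using basic_translatable less.prems \<chi> by blast
    next
      case neq: False
      obtain S1 U1 where 1:
        "trans_step (insert a U) (D\<lparr>pinit := app1 a 0 (pvars D)\<rparr>) \<chi> S1 U1" "finite U1"
        using basic_translatable[of "insert a U" \<chi>] less.prems \<chi> by blast
      obtain Q \<psi> where "\<chi> = PathQ Q \<psi>" using \<chi> by (auto simp: basic_def)
      then have "2 \<le> weight (\<lambda>_. 1) \<chi>" using weight_pos[of "\<lambda>_. 1" \<psi>] by simp
      then have "weight (\<lambda>_. 1) \<phi>' < weight (\<lambda>_. 1) \<phi>"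
        using weight_repl[OF \<chi>(2,3), of "\<lambda>_. 1"] by simp
      moreover have "state_formula \<phi>'" using repl_state_formula[OF \<chi>(2)] less.prems by simp
      ultimately obtain S2 U2 where "trans_step U1 D \<phi>' S2 U2" "finite U2"
        using less.hyps 1(2) by blast
      then show ?thesis using trans_step.sub[OF \<chi>(1) neq a \<chi>(2,3) 1(1)] by blast
    qed
  qed
qed

lemma finite_preds: "finite (preds c)"
  by (induction c) auto

theorem theorem1:
  "\<exists>C::nat. \<forall>(D::('f, 'r) program) \<phi>.
     wf_program D \<and> spec_formula D \<phi> \<longrightarrow>
     (let m = size_of_program D; k = length (pfair D); n = size_of_ctls \<phi> in
      (\<exists>S. Trans D \<phi> S) \<and>
      (\<forall>S. Trans D \<phi> S \<longrightarrow>
         finite S \<and>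
         card S \<le> C * (n * (n + k)) \<and>
         size_of_clauses S \<le> C * (n * (n + k) * (n + m))))"
\<comment> \<open>2000 covers both 1950 + 3 in the size bound and 10 + 1 in the number of
  clauses.\<close>
proof (intro exI[of _ 2000] allI impI, elim conjE)
  fix D :: "('f, 'r) program" and \<phi> :: "('f, 'r) fm ctls"
  assume "spec_formula D \<phi>"
  define m where "m = size_of_program D"
  define k where "k = length (pfair D)"
  define n where "n = size_of_ctls \<phi>"
  have "\<exists>S. Trans D \<phi> S"
    using state_formula_translatable[OF finite_preds, of \<phi> "pinit D" D] \<open>spec_formula D \<phi>\<close>
    by (auto simp: Trans_def spec_formula_def)
  moreover have "finite S \<and> card S \<le> 2000 * (n * (n + k)) \<and>
      size_of_clauses S \<le> 2000 * (n * (n + k) * (n + m))" if S: "Trans D \<phi> S" for S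
  proof -
    let ?w = "weight (trunc m) \<phi>"
    obtain U where step: "trans_step (preds (pinit D)) D \<phi> S U"
      using S by (auto simp: Trans_def)
    \<comment> \<open>The initial condition has at least one symbol and is counted in
      \<open>m\<close> besides the core, so \<open>m\<close> can serve as the truncation
      level.\<close>
    have "core_size D + 1 \<le> m" "size_of_fm (pinit D) \<le> m"
      using size_of_fm_pos[of "pinit D"] by (auto simp: m_def size_of_program_def core_size_def)
    moreover have w: "?w \<le> n" using weight_trunc_le_size by (simp add: n_def)
    ultimately have fin: "finite S" and card: "card S \<le> 10 * ((?w - 1) * (n + k)) + 1"
      and size: "size_of_clauses S \<le> 1950 * ((?w - 1) * (n + k) * m) + 3 * (n * m)"
      using state_formula_bounds[OF step, of m n] by (auto simp: k_def)
    have n: "1 \<le> n"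
      unfolding n_def size_of_ctls_eq_weight by (rule weight_pos) (rule size_of_fm_pos)
    have "(?w - 1) * (n + k) \<le> n * (n + k)" using w by (intro mult_le_mono) auto
    moreover have "1 \<le> n * (n + k)" using n by simp
    ultimately have "card S \<le> 2000 * (n * (n + k))" using card by linarith
    moreover have "(?w - 1) * (n + k) * m \<le> n * (n + k) * (n + m)"
      using w by (intro mult_le_mono) auto
    moreover have "n * 1 * m \<le> n * (n + k) * (n + m)"
      using n by (intro mult_le_mono) auto
    then have "n * m \<le> n * (n + k) * (n + m)" by simp
    ultimately show ?thesis using fin size by linarith
  qed
  ultimately show "let m = size_of_program D; k = length (pfair D); n = size_of_ctls \<phi> in
      (\<exists>S. Trans D \<phi> S) \<and>
      (\<forall>S. Trans D \<phi> S \<longrightarrow>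
         finite S \<and>
         card S \<le> 2000 * (n * (n + k)) \<and>
         size_of_clauses S \<le> 2000 * (n * (n + k) * (n + m)))"
    by (simp add: Let_def m_def k_def n_def)
qed

end
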